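(* Let $n\ge 2$ be an integer and, for $k\ge 0$, let $f_n(k)$ be the number of lower decorated sweep covers with exactly $k$ colours in the infinite $n$-ary tree poset. Then for all $k\ge 0$, \[ f_n(k)=\sum_{u=0}^{n}\sum_{k'=0}^u\binom{n}{u}{u \brace k'}\sum_{\substack{k_1+\dots+k_{n-u}=k-k'\\k_j\ge1}}\ \prod_{j=1}^{n-u}f_n(k_j), \] where ${u \brace k'}$ is a Stirling number of the second kind, and for $u=n$ the innermost sum (over empty tuples) equals $1$ if $k'=k$ and $0$ otherwise.
   Context: In a poset, $p$ covers $q$ if $q<p$ and there is no $r$ with $q<r<p$. The elements covered by $p$ are its children, the elements covering $p$ are its parents, and elements having a common parent are siblings. The infinite $n$-ary tree poset is the poset with a maximum element (the root) $p_0$ whose Hasse diagram is the infinite rooted tree in which every element has exactly $n$ children (equivalently: finite words over an $n$-letter alphabet, with $p\ge q$ iff $p$ is a prefix of $q$). An antichain is a set of pairwise incomparable elements; it is maximal if every element not in it is comparable to at least one of its elements. A decorated sweep cover (DSC) with exactly $k$ colours is a colouring $c:S\to\mathcal K$ of a maximal antichain $S$, using all $k$ colours of a $k$-element set $\mathcal K$, such that any two distinct $p,q\in S$ with $c(p)=c(q)$ are siblings; DSCs are counted up to permutation of the colours (so such a DSC amounts to a maximal antichain $S$ with a partition of $S$ into $k$ nonempty blocks of mutual siblings). A lower DSC is one whose antichain is not the singleton $\{p_0\}$ of the root. *)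

theory Defs
  imports
    Complex_Main
    "HOL-Library.FuncSet"
    "HOL-Library.Sublist"
    "HOL-Combinatorics.Permutations"
    "HOL-Combinatorics.Stirling"
begin

text \<open>
  A poset is given by its reflexive order relation \<open>r\<close>, where \<open>(q, p) \<in> r\<close> means that
  \<open>q\<close> is below or equal to \<open>p\<close>; its carrier is \<open>Field r\<close>.
\<close>

definition covers :: "'a rel \<Rightarrow> 'a \<Rightarrow> 'a \<Rightarrow> bool" where
  "covers r p q \<longleftrightarrow> (q, p) \<in> r \<and> q \<noteq> p \<and>
     \<not> (\<exists>t. (q, t) \<in> r \<and> q \<noteq> t \<and> (t, p) \<in> r \<and> t \<noteq> p)"

definition siblings :: "'a rel \<Rightarrow> 'a \<Rightarrow> 'a \<Rightarrow> bool" where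
  "siblings r p q \<longleftrightarrow> (\<exists>t. covers r t p \<and> covers r t q)"

definition comparable :: "'a rel \<Rightarrow> 'a \<Rightarrow> 'a \<Rightarrow> bool" where
  "comparable r p q \<longleftrightarrow> (p, q) \<in> r \<or> (q, p) \<in> r"

definition antichain :: "'a rel \<Rightarrow> 'a set \<Rightarrow> bool" where
  "antichain r S \<longleftrightarrow> S \<subseteq> Field r \<and> (\<forall>p\<in>S. \<forall>q\<in>S. p \<noteq> q \<longrightarrow> \<not> comparable r p q)"

definition maximal_antichain :: "'a rel \<Rightarrow> 'a set \<Rightarrow> bool" where
  "maximal_antichain r S \<longleftrightarrow>
     antichain r S \<and> (\<forall>p\<in>Field r - S. \<exists>q\<in>S. comparable r p q)"

text \<open>
  The colour set is \<open>{..<k}\<close>. A colouring is a map with domain exactly \<open>S\<close>, hence extensional.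
\<close>

definition dsc :: "'a rel \<Rightarrow> nat \<Rightarrow> ('a set \<times> ('a \<Rightarrow> nat)) set" where
  "dsc r k = {(S, c). maximal_antichain r S \<and> c \<in> S \<rightarrow>\<^sub>E {..<k} \<and> c ` S = {..<k} \<and>
     (\<forall>p\<in>S. \<forall>q\<in>S. p \<noteq> q \<and> c p = c q \<longrightarrow> siblings r p q)}"

definition recolouring ::
    "('a set \<times> ('a \<Rightarrow> nat)) set \<Rightarrow> nat \<Rightarrow> ('a set \<times> ('a \<Rightarrow> nat)) rel" where
  "recolouring D k = {((S, c), (T, d)). (S, c) \<in> D \<and> (T, d) \<in> D \<and> S = T \<and>
     (\<exists>\<pi>. \<pi> permutes {..<k} \<and> (\<forall>p\<in>S. d p = \<pi> (c p)))}"

text \<open>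
  The infinite \<open>n\<close>-ary tree: its elements are the words over \<open>{..<n}\<close>, and a word lies below
  each of its prefixes. The root is the empty word.
\<close>

definition nary_tree :: "nat \<Rightarrow> nat list rel" where
  "nary_tree n = {(q, p). p \<in> lists {..<n} \<and> q \<in> lists {..<n} \<and> prefix p q}"

definition lower_dsc :: "nat \<Rightarrow> nat \<Rightarrow> (nat list set \<times> (nat list \<Rightarrow> nat)) set" where
  "lower_dsc n k = {(S, c) \<in> dsc (nary_tree n) k. S \<noteq> {[]}}"

text \<open>
  For \<open>n \<ge> 2\<close> the quotient below is finite (an antichain with \<open>k\<close> colours has at most \<open>k * n\<close>
  elements), so \<open>card\<close> is its genuine cardinality.
\<close>

definition lower_dsc_count :: "nat \<Rightarrow> nat \<Rightarrow> nat" where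
  "lower_dsc_count n k = card (lower_dsc n k // recolouring (lower_dsc n k) k)"

lemma Field_nary_tree: "Field (nary_tree n) = lists {..<n}"
  by (auto simp: nary_tree_def Field_def)

lemma partial_order_nary_tree: "partial_order_on (lists {..<n}) (nary_tree n)"
  unfolding partial_order_on_def preorder_on_def refl_on_def trans_def antisym_def nary_tree_def
  by auto

lemma root_greatest_nary_tree: "p \<in> lists {..<n} \<Longrightarrow> (p, []) \<in> nary_tree n"
  by (simp add: nary_tree_def)

lemma covers_nary_tree:
  assumes "p \<in> lists {..<n}"
  shows "covers (nary_tree n) p q \<longleftrightarrow> (\<exists>i<n. q = p @ [i])"
proof
  assume c: "covers (nary_tree n) p q"
  then have pq: "prefix p q" "q \<noteq> p" "q \<in> lists {..<n}"
    by (simp_all add: covers_def nary_tree_def)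
  then obtain zs where zs0: "q = p @ zs"
    unfolding prefix_def by blast
  with pq(2) have "zs \<noteq> []" by simp
  note q = zs0 this pq(3)
  from q(2) obtain i ys where zs: "zs = i # ys" by (cases zs) auto
  have "ys = []"
  proof (rule ccontr)
    assume "ys \<noteq> []"
    then have "(q, p @ [i]) \<in> nary_tree n" "q \<noteq> p @ [i]" "(p @ [i], p) \<in> nary_tree n"
      using q zs assms by (simp_all add: nary_tree_def)
    with c show False unfolding covers_def by blast
  qed
  with q zs show "\<exists>i<n. q = p @ [i]" by simp
next
  assume "\<exists>i<n. q = p @ [i]"
  with assms show "covers (nary_tree n) p q"
    by (auto simp: covers_def nary_tree_def dest: prefix_order.antisym)
qed

lemma equiv_recolouring: "equiv D (recolouring D k)"
proof (rule equivI)
  show "recolouring D k \<subseteq> D \<times> D"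
    by (auto simp: recolouring_def)
  show "refl_on D (recolouring D k)"
    by (auto simp: refl_on_def recolouring_def intro!: exI[of _ id] permutes_id)
  show "sym (recolouring D k)"
  proof (rule symI, clarify)
    fix S c T d assume "((S, c), (T, d)) \<in> recolouring D k"
    then obtain \<pi> where D: "(S, c) \<in> D" "(T, d) \<in> D" "S = T" and
      \<pi>: "\<pi> permutes {..<k}" "\<forall>p\<in>S. d p = \<pi> (c p)"
      by (auto simp: recolouring_def)
    have "\<forall>p\<in>S. c p = inv \<pi> (d p)"
      using \<pi> by (simp add: permutes_inverses)
    with D permutes_inv[OF \<pi>(1)] show "((T, d), (S, c)) \<in> recolouring D k"
      by (auto simp: recolouring_def)
  qed
  show "trans (recolouring D k)"
  proof (rule transI, clarify)
    fix S c T d U e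
    assume "((S, c), (T, d)) \<in> recolouring D k" "((T, d), (U, e)) \<in> recolouring D k"
    then obtain \<pi> \<sigma> where D: "(S, c) \<in> D" "(U, e) \<in> D" "S = T" "T = U" and
      \<pi>: "\<pi> permutes {..<k}" "\<forall>p\<in>S. d p = \<pi> (c p)" and
      \<sigma>: "\<sigma> permutes {..<k}" "\<forall>p\<in>S. e p = \<sigma> (d p)"
      by (auto simp: recolouring_def)
    have "\<forall>p\<in>S. e p = (\<sigma> \<circ> \<pi>) (c p)"
      using \<pi>(2) \<sigma>(2) by simp
    with D permutes_compose[OF \<pi>(1) \<sigma>(1)] show "((S, c), (U, e)) \<in> recolouring D k"
      by (auto simp: recolouring_def)
  qed
qed

end

theory Submission
  imports Defs "HOL-Library.Disjoint_Sets"
begin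

text \<open>
  A decorated sweep cover up to recolouring is the partition of its antichain into colour classes.
  In the tree, distinct nonempty words are siblings iff deleting the last letter gives the same word.
  Let \<open>U\<close> be the set of children of the root that lie in the antichain. A lower sweep cover is then
  a partition \<open>R\<close> of \<open>U\<close> together with an arbitrary lower sweep cover below each of the other
  children, since blocks of siblings cannot cross between subtrees. The number of blocks is
  additive, and the partitions of a \<open>u\<close>-set into \<open>k'\<close> blocks are counted by a Stirling number.
  Because \<open>n \<ge> 2\<close>, every grafted piece has fewer blocks than the whole, so all counts are finite by
  induction on the number of blocks.
\<close>

subsection \<open>Maximal antichains of the tree\<close>

text \<open>Both orders of \<open>p\<close> and \<open>q\<close> are quantified over, so one prefix
  condition covers both directions of comparability. The maximality clause may range over all words
  because an element of \<open>S\<close> is a prefix of itself.\<close>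

lemma maximal_antichain_nary_tree:
  "maximal_antichain (nary_tree n) S \<longleftrightarrow>
     S \<subseteq> lists {..<n} \<and> (\<forall>p\<in>S. \<forall>q\<in>S. prefix p q \<longrightarrow> p = q) \<and>
     (\<forall>p\<in>lists {..<n}. \<exists>q\<in>S. prefix p q \<or> prefix q p)" (is "?L \<longleftrightarrow> ?R")
proof
  assume ?L
  then have 1: "S \<subseteq> lists {..<n}" and 2: "\<forall>p\<in>S. \<forall>q\<in>S. p \<noteq> q \<longrightarrow> \<not> comparable (nary_tree n) p q"
    and 3: "\<forall>p\<in>lists {..<n} - S. \<exists>q\<in>S. comparable (nary_tree n) p q"
    by (auto simp only: maximal_antichain_def antichain_def Field_nary_tree)
  have "\<exists>q\<in>S. prefix p q \<or> prefix q p" if "p \<in> lists {..<n}" for p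
    using 3 that by (cases "p \<in> S") (auto simp: comparable_def nary_tree_def)
  moreover have "p = q" if "p \<in> S" "q \<in> S" "prefix p q" for p q
  proof (rule ccontr)
    assume "p \<noteq> q"
    then have "(q, p) \<notin> nary_tree n" using 2 that(1,2) by (auto simp: comparable_def)
    moreover have "p \<in> lists {..<n}" "q \<in> lists {..<n}" using 1 that by auto
    ultimately show False using that(3) by (simp add: nary_tree_def)
  qed
  ultimately show ?R using 1 by blast
next
  assume R: ?R
  then have sub: "\<And>p. p \<in> S \<Longrightarrow> p \<in> lists {..<n}" by blast
  have cmp: "comparable (nary_tree n) p q \<longleftrightarrow> prefix p q \<or> prefix q p"
    if "p \<in> lists {..<n}" "q \<in> lists {..<n}" for p q
    using that by (auto simp: comparable_def nary_tree_def)
  have "antichain (nary_tree n) S"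
    unfolding antichain_def Field_nary_tree
  proof (intro conjI ballI impI)
    show "S \<subseteq> lists {..<n}" using R by blast
    fix p q assume "p \<in> S" "q \<in> S" "p \<noteq> q"
    with cmp[of p q] sub R show "\<not> comparable (nary_tree n) p q" by blast
  qed
  moreover have "\<exists>q\<in>S. comparable (nary_tree n) p q" if p: "p \<in> lists {..<n}" for p
  proof -
    obtain q where "q \<in> S" "prefix p q \<or> prefix q p" using R p by meson
    with cmp[OF p sub] show ?thesis by blast
  qed
  ultimately show ?L unfolding maximal_antichain_def Field_nary_tree by blast
qed

lemma maximal_antichain_nonempty: "maximal_antichain (nary_tree n) S \<Longrightarrow> S \<noteq> {}"
  unfolding maximal_antichain_nary_tree by (drule conjunct2, drule conjunct2, drule bspec[of _ _ "[]"]) auto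

lemma maximal_antichain_root: "maximal_antichain (nary_tree n) {[]}"
  unfolding maximal_antichain_nary_tree by auto

text \<open>The empty word is a prefix of every word, so an antichain containing it contains nothing
  else. The condition defining lower sweep covers thereby becomes
  \<open>[] \<notin> S\<close>.\<close>

lemma maximal_antichain_Nil_iff:
  assumes "maximal_antichain (nary_tree n) S"
  shows "[] \<in> S \<longleftrightarrow> S = {[]}"
proof
  assume "[] \<in> S"
  moreover have "p = []" if "p \<in> S" for p
  proof -
    have "prefix [] p" by simp
    then show ?thesis
      using assms \<open>[] \<in> S\<close> that unfolding maximal_antichain_nary_tree by metis
  qed
  ultimately show "S = {[]}" by blast
qed simp

text \<open>Words with distinct first letters are incomparable, and for a common first letter
  comparability is that of the tails, so each subtree can be tested separately. The case
  \<open>n = 0\<close> must be excluded: there \<open>S = {}\<close> satisfies the right side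
  vacuously but is not maximal.\<close>

lemma maximal_antichain_Cons:
  assumes "n > 0" "[] \<notin> S"
  shows "maximal_antichain (nary_tree n) S \<longleftrightarrow>
    hd ` S \<subseteq> {..<n} \<and> (\<forall>i<n. maximal_antichain (nary_tree n) {w. i # w \<in> S})"
    (is "?L \<longleftrightarrow> ?R")
proof
  assume L: ?L
  then have 1: "S \<subseteq> lists {..<n}" and 2: "\<And>p q. p \<in> S \<Longrightarrow> q \<in> S \<Longrightarrow> prefix p q \<Longrightarrow> p = q"
    and 3: "\<And>p. p \<in> lists {..<n} \<Longrightarrow> \<exists>q\<in>S. prefix p q \<or> prefix q p"
    unfolding maximal_antichain_nary_tree by blast+
  have "hd p < n" if "p \<in> S" for p
  proof -
    have "p \<in> lists {..<n}" "p \<noteq> []" using that 1 assms by auto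
    then show ?thesis by (cases p) auto
  qed
  moreover have "\<exists>q. i # q \<in> S \<and> (prefix p q \<or> prefix q p)" if i: "i < n" and p: "p \<in> lists {..<n}" for i p
  proof -
    obtain q where q: "q \<in> S" "prefix (i # p) q \<or> prefix q (i # p)"
      using 3[of "i # p"] i p by auto
    moreover have "q \<noteq> []" using q assms by auto
    ultimately show ?thesis by (cases q) auto
  qed
  moreover have "w \<in> lists {..<n}" if "i # w \<in> S" for i w
    using 1 that by auto
  moreover have "p = q" if "i # p \<in> S" "i # q \<in> S" "prefix p q" for i p q
    using 2[OF that(1,2)] that(3) by simp
  ultimately show ?R unfolding maximal_antichain_nary_tree by blast
next
  assume R: ?R
  have 1: "w \<in> lists {..<n}" if "i # w \<in> S" "i < n" for i w
    using R that unfolding maximal_antichain_nary_tree by blast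
  have 2: "p = q" if "i # p \<in> S" "i # q \<in> S" "prefix p q" "i < n" for i p q
    using R that unfolding maximal_antichain_nary_tree by blast
  have 3: "\<exists>q. i # q \<in> S \<and> (prefix p q \<or> prefix q p)" if "i < n" "p \<in> lists {..<n}" for i p
  proof -
    have "maximal_antichain (nary_tree n) {w. i # w \<in> S}" using R that by blast
    then have "\<exists>q\<in>{w. i # w \<in> S}. prefix p q \<or> prefix q p"
      using that(2) unfolding maximal_antichain_nary_tree by meson
    then show ?thesis by simp
  qed
  have hd: "i < n" if "i # w \<in> S" for i w
  proof -
    have "hd (i # w) \<in> {..<n}" using R that by blast
    then show ?thesis by simp
  qed
  show ?L unfolding maximal_antichain_nary_tree
  proof (intro conjI subsetI ballI impI)
    fix p assume "p \<in> S"
    then show "p \<in> lists {..<n}" using assms hd 1 by (cases p) auto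
  next
    fix p q assume "p \<in> S" "q \<in> S" "prefix p q"
    then show "p = q" using assms hd 2 by (cases p; cases q) auto
  next
    fix p :: "nat list" assume p: "p \<in> lists {..<n}"
    show "\<exists>q\<in>S. prefix p q \<or> prefix q p"
    proof (cases p)
      case Nil
      obtain q where "0 # q \<in> S" using 3[of 0 "[]"] assms by auto
      then show ?thesis using Nil by auto
    next
      case (Cons i w)
      then obtain q where "i # q \<in> S" "prefix w q \<or> prefix q w"
        using 3[of i w] p by auto
      then show ?thesis using Cons by (intro bexI[of _ "i # q"]) auto
    qed
  qed
qed

text \<open>The only parent of a nonempty word is its \<open>butlast\<close>. The root has to be
  excluded, since \<open>butlast [] = []\<close> would make it a sibling of the one-letter
  words.\<close>

lemma siblings_nary_tree:
  assumes "p \<in> lists {..<n}" "q \<in> lists {..<n}" "p \<noteq> []" "q \<noteq> []"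
  shows "siblings (nary_tree n) p q \<longleftrightarrow> butlast p = butlast q"
proof
  assume "siblings (nary_tree n) p q"
  then obtain t where t: "covers (nary_tree n) t p" "covers (nary_tree n) t q"
    by (auto simp: siblings_def)
  then have "t \<in> lists {..<n}" by (auto simp: covers_def nary_tree_def)
  with t show "butlast p = butlast q" by (auto simp: covers_nary_tree)
next
  assume eq: "butlast p = butlast q"
  have p: "p = butlast p @ [last p]" and q: "q = butlast p @ [last q]"
    using assms(3,4) by (simp, simp add: eq)
  have "butlast p @ [last p] \<in> lists {..<n}" "butlast p @ [last q] \<in> lists {..<n}"
    using p q assms(1,2) by simp_all
  then have "butlast p \<in> lists {..<n}" "last p < n" "last q < n"
    by auto
  then have "covers (nary_tree n) (butlast p) p" "covers (nary_tree n) (butlast p) q"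
    using p q covers_nary_tree by blast+
  then show "siblings (nary_tree n) p q" by (auto simp: siblings_def)
qed

subsection \<open>Splitting a sweep cover at the root\<close>

text \<open>The antichain is not stored but recovered as \<open>\<Union>P\<close>, so
  \<open>partition_on\<close> only says that the blocks are nonempty and disjoint. Finiteness
  matters because infinite maximal antichains exist for \<open>n \<ge> 2\<close>, and
  \<open>card\<close> would give their infinite partitions 0 blocks.\<close>

definition lower_partitions :: "nat \<Rightarrow> nat list set set set" where
  "lower_partitions n = {P. finite P \<and> maximal_antichain (nary_tree n) (\<Union>P) \<and> [] \<notin> \<Union>P \<and>
     partition_on (\<Union>P) P \<and> (\<forall>B\<in>P. \<forall>p\<in>B. \<forall>q\<in>B. butlast p = butlast q)}"

definition root_partitions :: "nat \<Rightarrow> nat set set set" where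
  "root_partitions n = {R. partition_on (\<Union>R) R \<and> \<Union>R \<subseteq> {..<n}}"

text \<open>Letters in \<open>\<Union>R\<close> become one-letter words; \<open>F i\<close> is hung below each remaining letter \<open>i\<close>.\<close>

definition graft :: "nat \<Rightarrow> nat set set \<times> (nat \<Rightarrow> nat list set set) \<Rightarrow> nat list set set" where
  "graft n = (\<lambda>(R, F). (\<lambda>B. (\<lambda>i. [i]) ` B) ` R \<union> (\<Union>i\<in>{..<n} - \<Union>R. (\<lambda>B. Cons i ` B) ` F i))"

text \<open>Extensionality of \<open>F\<close> leaves no freedom outside the remaining letters, as
  injectivity of \<open>graft\<close> requires.\<close>

definition graft_domain where
  "graft_domain n = (SIGMA R:root_partitions n. ({..<n} - \<Union>R) \<rightarrow>\<^sub>E lower_partitions n)"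

section \<open>Grafting as a bijection onto the lower partitions\<close>

lemma lower_partitionsD:
  assumes "P \<in> lower_partitions n"
  shows "finite P" "maximal_antichain (nary_tree n) (\<Union>P)" "[] \<notin> \<Union>P" "{} \<notin> P" "P \<noteq> {}"
    "\<And>B C. B \<in> P \<Longrightarrow> C \<in> P \<Longrightarrow> B \<noteq> C \<Longrightarrow> B \<inter> C = {}"
    "\<And>B p q. B \<in> P \<Longrightarrow> p \<in> B \<Longrightarrow> q \<in> B \<Longrightarrow> butlast p = butlast q"
proof -
  have *: "finite P" "maximal_antichain (nary_tree n) (\<Union>P)" "[] \<notin> \<Union>P" "partition_on (\<Union>P) P"
    "\<forall>B\<in>P. \<forall>p\<in>B. \<forall>q\<in>B. butlast p = butlast q"
    using assms unfolding lower_partitions_def mem_Collect_eq by blast+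
  have "\<And>B C. B \<in> P \<Longrightarrow> C \<in> P \<Longrightarrow> B \<noteq> C \<Longrightarrow> B \<inter> C = {}" "{} \<notin> P"
    using *(4) by (auto simp: partition_on_def disjoint_def)
  with *(1-3) *(5)[rule_format] show "finite P" "maximal_antichain (nary_tree n) (\<Union>P)" "[] \<notin> \<Union>P" "{} \<notin> P"
    "\<And>B C. B \<in> P \<Longrightarrow> C \<in> P \<Longrightarrow> B \<noteq> C \<Longrightarrow> B \<inter> C = {}"
    "\<And>B p q. B \<in> P \<Longrightarrow> p \<in> B \<Longrightarrow> q \<in> B \<Longrightarrow> butlast p = butlast q"
    by blast+
  show "P \<noteq> {}" using maximal_antichain_nonempty[OF *(2)] by blast
qed

lemma graft_in_lower_partitions:
  assumes n: "n > 0" and dom: "(R, F) \<in> graft_domain n"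
  shows "graft n (R, F) \<in> lower_partitions n"
proof -
  let ?I = "{..<n} - \<Union>R"
  let ?G = "graft n (R, F)"
  have R: "{} \<notin> R" "\<Union>R \<subseteq> {..<n}" "\<And>B C. B \<in> R \<Longrightarrow> C \<in> R \<Longrightarrow> B \<noteq> C \<Longrightarrow> B \<inter> C = {}"
    using dom by (auto simp: graft_domain_def root_partitions_def partition_on_def disjoint_def)
  have F: "F i \<in> lower_partitions n" if "i \<in> ?I" for i
    using dom that by (auto simp: graft_domain_def PiE_iff)
  note FD = lower_partitionsD[OF F]
  have cases: thesis
    if "B \<in> ?G" "\<And>X. X \<in> R \<Longrightarrow> B = (\<lambda>i. [i]) ` X \<Longrightarrow> thesis"
      "\<And>i X. i \<in> ?I \<Longrightarrow> X \<in> F i \<Longrightarrow> B = Cons i ` X \<Longrightarrow> thesis" for B thesis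
    using that by (auto simp: graft_def)
  have Un: "\<Union>?G = {[i] |i. i \<in> \<Union>R} \<union> {i # w |i w. i \<in> ?I \<and> w \<in> \<Union>(F i)}"
  proof (intro equalityI subsetI)
    fix x assume "x \<in> \<Union>?G"
    then obtain B where B: "B \<in> ?G" "x \<in> B" by blast
    from B(1) show "x \<in> {[i] |i. i \<in> \<Union>R} \<union> {i # w |i w. i \<in> ?I \<and> w \<in> \<Union>(F i)}"
      by (rule cases) (use B(2) in blast)+
  next
    fix x assume "x \<in> {[i] |i. i \<in> \<Union>R} \<union> {i # w |i w. i \<in> ?I \<and> w \<in> \<Union>(F i)}"
    then consider i X where "x = [i]" "X \<in> R" "i \<in> X"
      | i w X where "x = i # w" "i \<in> ?I" "X \<in> F i" "w \<in> X" by blast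
    then show "x \<in> \<Union>?G"
    proof cases
      case 1
      then have "(\<lambda>i. [i]) ` X \<in> ?G" "x \<in> (\<lambda>i. [i]) ` X" by (simp_all add: graft_def)
      then show ?thesis by blast
    next
      case 2
      have "Cons i ` X \<in> ?G" unfolding graft_def prod.case using 2(2,3) by blast
      moreover have "x \<in> Cons i ` X" using 2(1,4) by simp
      ultimately show ?thesis by blast
    qed
  qed
  have finR: "finite R" using finite_UnionD[OF finite_subset[OF R(2) finite_lessThan]] .
  have fin: "finite ?G" using finR FD(1) by (auto simp: graft_def)
  \<comment> \<open>Below a letter of \<open>\<Union>R\<close> only the root of that subtree is
    present; below any other letter it is the union of the grafted piece. Both are maximal
    antichains, which is what \<open>maximal_antichain_Cons\<close> asks for.\<close>
  have sub: "{w. i # w \<in> \<Union>?G} = (if i \<in> \<Union>R then {[]} else \<Union>(F i))" if "i < n" for i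
    using that unfolding Un by auto
  have Nil: "[] \<notin> \<Union>?G" unfolding Un by blast
  have "hd ` \<Union>?G \<subseteq> {..<n}" unfolding Un using R(2) by auto
  moreover have "maximal_antichain (nary_tree n) {w. i # w \<in> \<Union>?G}" if "i < n" for i
    unfolding sub[OF that] using maximal_antichain_root FD(2)[of i] that by simp
  ultimately have max: "maximal_antichain (nary_tree n) (\<Union>?G)"
    using maximal_antichain_Cons[OF n Nil] by blast
  have ne: "{} \<notin> ?G" using R(1) FD(4) by (auto simp: graft_def)
  have bl: "butlast p = butlast q" if B: "B \<in> ?G" and pq: "p \<in> B" "q \<in> B" for B p q
    using B
  proof (rule cases)
    fix i X assume X: "i \<in> ?I" "X \<in> F i" "B = Cons i ` X"
    obtain p' where p': "p = i # p'" "p' \<in> X" using pq X(3) by blast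
    obtain q' where q': "q = i # q'" "q' \<in> X" using pq X(3) by blast
    \<comment> \<open>Prefixing \<open>i\<close> commutes with \<open>butlast\<close> on nonempty
      words, but not on the empty word, as \<open>butlast [i] = []\<close>.\<close>
    have "p' \<noteq> []" "q' \<noteq> []" using FD(3)[OF X(1)] X(2) p' q' by auto
    then show ?thesis using FD(7)[OF X(1,2) p'(2) q'(2)] p' q' by simp
  qed (use pq in auto)
  have mix: "(\<lambda>i. [i]) ` X \<inter> Cons i ` Y = {}" if "i \<in> ?I" "Y \<in> F i" for i X Y
    using FD(3)[OF that(1)] that(2) by auto
  have disj: "B \<inter> C = {}" if B: "B \<in> ?G" and C: "C \<in> ?G" and "B \<noteq> C" for B C
    using B
  proof (rule cases)
    fix X assume X: "X \<in> R" "B = (\<lambda>i. [i]) ` X"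
    from C show ?thesis
    proof (rule cases)
      fix Y assume Y: "Y \<in> R" "C = (\<lambda>i. [i]) ` Y"
      then show ?thesis using X R(3)[of X Y] \<open>B \<noteq> C\<close> by auto
    qed (use X mix in blast)
  next
    fix i X assume X: "i \<in> ?I" "X \<in> F i" "B = Cons i ` X"
    from C show ?thesis
    proof (rule cases)
      fix j Y assume Y: "j \<in> ?I" "Y \<in> F j" "C = Cons j ` Y"
      then show ?thesis using X FD(6)[of i X Y] \<open>B \<noteq> C\<close> by (cases "i = j") auto
    qed (use X mix in blast)
  qed
  have "partition_on (\<Union>?G) ?G"
    using ne disj by (auto simp: partition_on_def disjoint_def)
  then show ?thesis unfolding lower_partitions_def using fin max Nil bl by blast
qed

text \<open>A grafted block contains a word of length at least 2, so a set of one-letter words can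
  only come from \<open>R\<close>. This recovers \<open>R\<close> from the graft; the next lemma
  recovers \<open>F\<close>, and together they give injectivity.\<close>

lemma graft_root_block:
  assumes dom: "(R, F) \<in> graft_domain n"
  shows "(\<lambda>i. [i]) ` B \<in> graft n (R, F) \<longleftrightarrow> B \<in> R"
proof -
  have *: "{} \<notin> F i" "[] \<notin> \<Union>(F i)" if "i \<in> {..<n} - \<Union>R" for i
    using dom that lower_partitionsD(3,4)[of "F i" n] by (auto simp: graft_domain_def PiE_iff)
  have inj: "inj ((`) (\<lambda>i::nat. [i]))" by (intro inj_on_image) (simp add: inj_on_def)
  have "(\<lambda>i. [i]) ` B \<noteq> Cons i ` Y" if Y: "i \<in> {..<n} - \<Union>R" "Y \<in> F i" for i Y
  proof
    assume eq: "(\<lambda>i. [i]) ` B = Cons i ` Y"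
    obtain w where w: "w \<in> Y" "w \<noteq> []" using *[OF Y(1)] Y(2) by (metis UnionI all_not_in_conv)
    then have "i # w \<in> (\<lambda>i. [i]) ` B" unfolding eq by blast
    with w show False by auto
  qed
  then have "(\<lambda>i. [i]) ` B \<notin> (\<Union>i\<in>{..<n} - \<Union>R. (\<lambda>B. Cons i ` B) ` F i)"
    by (auto simp del: Diff_iff)
  then have "(\<lambda>i. [i]) ` B \<in> graft n (R, F) \<longleftrightarrow> (\<lambda>i. [i]) ` B \<in> (`) (\<lambda>i. [i]) ` R"
    by (simp add: graft_def)
  then show ?thesis using inj by (simp add: inj_image_mem_iff)
qed

text \<open>Blocks are nonempty, so a word of the block can be inspected: its first letter
  identifies the subtree, and its length tells it from a word of a root block.\<close>

lemma graft_child_block: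
  assumes dom: "(R, F) \<in> graft_domain n" and i: "i \<in> {..<n} - \<Union>R"
  shows "[] \<notin> B \<and> Cons i ` B \<in> graft n (R, F) \<longleftrightarrow> B \<in> F i"
proof
  have *: "{} \<notin> F i" "[] \<notin> \<Union>(F i)" if "i \<in> {..<n} - \<Union>R" for i
    using dom that lower_partitionsD(3,4)[of "F i" n] by (auto simp: graft_domain_def PiE_iff)
  have R: "{} \<notin> R" using dom by (auto simp: graft_domain_def root_partitions_def partition_on_def)
  show "B \<in> F i \<Longrightarrow> [] \<notin> B \<and> Cons i ` B \<in> graft n (R, F)"
    using *[OF i] i unfolding graft_def prod.case by blast
  assume B: "[] \<notin> B \<and> Cons i ` B \<in> graft n (R, F)"
  then consider X where "X \<in> R" "Cons i ` B = (\<lambda>i. [i]) ` X"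
    | j X where "j \<in> {..<n} - \<Union>R" "X \<in> F j" "Cons i ` B = Cons j ` X"
    by (auto simp: graft_def)
  then show "B \<in> F i"
  proof cases
    case 1
    then obtain x where "x \<in> X" using R by fastforce
    then have "[x] \<in> Cons i ` B" using 1 by auto
    then show ?thesis using B by auto
  next
    case 2
    then obtain w where w: "w \<in> X" using *(1) by (metis all_not_in_conv)
    then have "j # w \<in> Cons i ` B" using 2 by auto
    then have "j = i" by auto
    moreover have "inj (Cons i)" by auto
    ultimately show ?thesis using 2 by (simp add: inj_image_eq_iff)
  qed
qed

lemma inj_on_graft: "inj_on (graft n) (graft_domain n)"
proof (rule inj_onI, clarify)
  fix R F R' F'
  assume d: "(R, F) \<in> graft_domain n" "(R', F') \<in> graft_domain n"
    and eq: "graft n (R, F) = graft n (R', F')"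
  have R: "R = R'"
    using graft_root_block[OF d(1)] graft_root_block[OF d(2)] eq by auto
  have "F i = F' i" if "i \<in> {..<n} - \<Union>R" for i
    using graft_child_block[OF d(1), of i] graft_child_block[OF d(2), of i] that eq R by blast
  moreover have "F \<in> ({..<n} - \<Union>R) \<rightarrow>\<^sub>E lower_partitions n" "F' \<in> ({..<n} - \<Union>R) \<rightarrow>\<^sub>E lower_partitions n"
    using d R by (simp_all add: graft_domain_def)
  ultimately have "F = F'" by (intro PiE_ext)
  with R show "R = R' \<and> F = F'" by simp
qed

lemma graft_surj:
  assumes n: "n > 0" and P: "P \<in> lower_partitions n"
  shows "P \<in> graft n ` graft_domain n"
proof -
  note PD = lower_partitionsD[OF P]
  \<comment> \<open>The membership tests for root and child blocks leave this \<open>R\<close> and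
    the \<open>F\<close> below as the only candidates.\<close>
  define R where "R = {B. (\<lambda>i. [i]) ` B \<in> P}"
  let ?I = "{..<n} - \<Union>R"
  define F where "F = (\<lambda>i\<in>?I. {B. [] \<notin> B \<and> Cons i ` B \<in> P})"
  have cases: "(\<exists>X\<in>R. B = (\<lambda>i. [i]) ` X) \<or> (\<exists>i X. [] \<notin> X \<and> Cons i ` X \<in> P \<and> B = Cons i ` X)"
    if B: "B \<in> P" for B
  proof -
    have "B \<noteq> {}" using PD(4) B by blast
    then obtain p where p: "p \<in> B" by blast
    have bl: "butlast q = butlast p" and qN: "q \<noteq> []" if "q \<in> B" for q
      using PD(3) PD(7)[OF B that p] B that by (simp, blast)
    \<comment> \<open>All words of \<open>B\<close> have the parent \<open>butlast p\<close>. If it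
      is the root, \<open>B\<close> consists of one-letter words; otherwise its first letter
      \<open>i\<close> is shared by all of \<open>B\<close>, and the tails are still
      nonempty.\<close>
    show ?thesis
    proof (cases "butlast p")
      case Nil
      have "q = [hd q]" if "q \<in> B" for q
        using bl[OF that] Nil qN[OF that] by (cases q) (auto split: if_splits)
      then have "B = (\<lambda>i. [i]) ` hd ` B" by (force simp: image_iff)
      then show ?thesis using B unfolding R_def by (metis mem_Collect_eq)
    next
      case (Cons i v)
      have *: "q = i # tl q" "tl q \<noteq> []" if "q \<in> B" for q
        using bl[OF that] Cons qN[OF that] by (cases q; auto split: if_splits)+
      then have "B = Cons i ` tl ` B" by (force simp: image_iff)
      moreover have "[] \<notin> tl ` B" using *(2) by force
      ultimately show ?thesis using B by metis
    qed
  qed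
  have hd: "hd ` \<Union>P \<subseteq> {..<n}" and sub: "\<And>i. i < n \<Longrightarrow> maximal_antichain (nary_tree n) {w. i # w \<in> \<Union>P}"
    using maximal_antichain_Cons[OF n PD(3)] PD(2) by blast+
  have Rsub: "\<Union>R \<subseteq> {..<n}"
  proof
    fix i assume "i \<in> \<Union>R"
    then have "[i] \<in> \<Union>P" unfolding R_def by blast
    then show "i \<in> {..<n}" using hd by force
  qed
  have "{} \<notin> R" using PD(4) by (simp add: R_def)
  moreover have "B \<inter> C = {}" if "B \<in> R" "C \<in> R" "B \<noteq> C" for B C
  proof -
    have "(\<lambda>i. [i]) ` B \<noteq> (\<lambda>i. [i]) ` C" using that(3) by (simp add: inj_image_eq_iff inj_def)
    then have "(\<lambda>i. [i]) ` B \<inter> (\<lambda>i. [i]) ` C = {}" using PD(6) that by (simp add: R_def)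
    then show ?thesis by blast
  qed
  ultimately have Rp: "R \<in> root_partitions n"
    using Rsub by (auto simp: root_partitions_def partition_on_def disjoint_def)
  have Fi: "F i \<in> lower_partitions n" if i: "i \<in> ?I" for i
  proof -
    have Fdef: "F i = {B. [] \<notin> B \<and> Cons i ` B \<in> P}" using i by (simp add: F_def)
    have "inj ((`) (Cons i))" by (simp add: inj_on_image)
    then have "finite ((`) (Cons i) -` P)" using PD(1) by (simp add: finite_vimageI)
    then have fin: "finite (F i)" by (rule rev_finite_subset) (auto simp: Fdef)
    have un: "\<Union>(F i) = {w. i # w \<in> \<Union>P}"
    proof (intro equalityI subsetI)
      fix w assume "w \<in> {w. i # w \<in> \<Union>P}"
      then obtain B where B: "B \<in> P" "i # w \<in> B" by blast
      have "B \<noteq> (\<lambda>i. [i]) ` X" if "X \<in> R" for X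
        using i that B(2) by auto
      then obtain j X where "[] \<notin> X" "Cons j ` X \<in> P" "B = Cons j ` X" using cases[OF B(1)] by blast
      with B(2) show "w \<in> \<Union>(F i)" unfolding Fdef by auto
    qed (auto simp: Fdef)
    have "{} \<notin> F i" using PD(4) by (simp add: Fdef)
    moreover have "B \<inter> C = {}" if "B \<in> F i" "C \<in> F i" "B \<noteq> C" for B C
    proof -
      have "Cons i ` B \<noteq> Cons i ` C" using that(3) by (simp add: inj_image_eq_iff)
      then have "Cons i ` B \<inter> Cons i ` C = {}" using PD(6) that by (simp add: Fdef)
      then show ?thesis by blast
    qed
    ultimately have "partition_on (\<Union>(F i)) (F i)" by (auto simp: partition_on_def disjoint_def)
    moreover have "butlast p = butlast q" if "B \<in> F i" "p \<in> B" "q \<in> B" for B p q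
    proof -
      have "p \<noteq> []" "q \<noteq> []" "Cons i ` B \<in> P" using that by (auto simp: Fdef)
      then show ?thesis using PD(7)[of "Cons i ` B" "i # p" "i # q"] that by simp
    qed
    moreover have "[] \<notin> \<Union>(F i)" by (auto simp: Fdef)
    moreover have "maximal_antichain (nary_tree n) (\<Union>(F i))" using sub[of i] i by (simp add: un)
    ultimately show ?thesis unfolding lower_partitions_def using fin by blast
  qed
  then have dom: "(R, F) \<in> graft_domain n"
    using Rp by (auto simp: graft_domain_def F_def)
  have "B \<in> graft n (R, F)" if B: "B \<in> P" for B
  proof (cases "\<exists>X\<in>R. B = (\<lambda>i. [i]) ` X")
    case True
    then show ?thesis by (auto simp: graft_def)
  next
    case False
    then obtain i X where X: "[] \<notin> X" "Cons i ` X \<in> P" "B = Cons i ` X" using cases[OF B] by blast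
    obtain w where w: "w \<in> X" using PD(4) B X(3) by fastforce
    then have "i # w \<in> \<Union>P" using X by blast
    then have "i < n" using hd by force
    \<comment> \<open>Otherwise \<open>[i]\<close> and its extension \<open>i # w\<close> would both
      lie in the antichain, which forces \<open>w = []\<close>.\<close>
    moreover have "i \<notin> \<Union>R"
    proof
      assume "i \<in> \<Union>R"
      then have iP: "[i] \<in> \<Union>P" unfolding R_def by blast
      have "prefix [i] (i # w)" by simp
      then have "[i] = i # w"
        using PD(2) iP \<open>i # w \<in> \<Union>P\<close> unfolding maximal_antichain_nary_tree by blast
      then show False using w X(1) by simp
    qed
    ultimately have "i \<in> ?I" by simp
    then show ?thesis using graft_child_block[OF dom, of i X] X by (auto simp: F_def)
  qed
  moreover have "B \<in> P" if "B \<in> graft n (R, F)" for B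
    using that by (auto simp: graft_def R_def F_def)
  ultimately have "P = graft n (R, F)" by (intro equalityI subsetI)
  then show ?thesis using dom by blast
qed

lemma bij_betw_graft: "n > 0 \<Longrightarrow> bij_betw (graft n) (graft_domain n) (lower_partitions n)"
proof (intro bij_betw_imageI inj_on_graft equalityI subsetI)
  fix P assume "n > 0" "P \<in> graft n ` graft_domain n"
  then obtain R F where "P = graft n (R, F)" "(R, F) \<in> graft_domain n" by (metis imageE surj_pair)
  then show "P \<in> lower_partitions n" using \<open>n > 0\<close> graft_in_lower_partitions by simp
qed (rule graft_surj)

lemma card_graft:
  assumes dom: "(R, F) \<in> graft_domain n"
  shows "card (graft n (R, F)) = card R + (\<Sum>i\<in>{..<n} - \<Union>R. card (F i))"
proof -
  let ?I = "{..<n} - \<Union>R"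
  have F: "F i \<in> lower_partitions n" if "i \<in> ?I" for i
    using dom that by (auto simp: graft_domain_def PiE_iff)
  note FD = lower_partitionsD[OF F]
  have R: "\<Union>R \<subseteq> {..<n}" using dom by (auto simp: graft_domain_def root_partitions_def)
  have finR: "finite R" using finite_UnionD[OF finite_subset[OF R finite_lessThan]] .
  let ?A = "(\<lambda>B. (\<lambda>i. [i]) ` B) ` R" and ?B = "\<lambda>i. (\<lambda>B. Cons i ` B) ` F i"
  \<comment> \<open>Such a word, of length at least 2 and with first letter \<open>i\<close>, shows
    that the block is neither a root block nor grafted below another letter. Hence no block is
    counted twice.\<close>
  have long: "\<exists>w. w \<noteq> [] \<and> i # w \<in> B" if iI: "i \<in> ?I" and B: "B \<in> ?B i" for i B
  proof -
    obtain X where X: "X \<in> F i" "B = Cons i ` X" using B by blast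
    then obtain w where "w \<in> X" "w \<noteq> []" using FD(3,4)[OF iI] by (metis UnionI all_not_in_conv)
    then show ?thesis using X by blast
  qed
  have AB: "?A \<inter> (\<Union>i\<in>?I. ?B i) = {}"
  proof -
    have "(\<lambda>i. [i]) ` X \<notin> ?B i" if i: "i \<in> ?I" for i X
    proof
      assume "(\<lambda>i. [i]) ` X \<in> ?B i"
      from long[OF i this] show False by auto
    qed
    then show ?thesis by (auto simp del: Diff_iff)
  qed
  have BB: "?B i \<inter> ?B j = {}" if ij: "i \<in> ?I" "j \<in> ?I" "i \<noteq> j" for i j
  proof (rule equals0I)
    fix B assume B: "B \<in> ?B i \<inter> ?B j"
    obtain w where "i # w \<in> B" using long[OF ij(1) IntD1[OF B]] by blast
    then show False using B ij(3) by auto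
  qed
  have "card (\<Union>i\<in>?I. ?B i) = (\<Sum>i\<in>?I. card (?B i))"
  proof (rule card_UN_disjoint)
    show "finite ?I" by simp
    show "\<forall>i\<in>?I. finite (?B i)" using FD(1) by (simp del: Diff_iff)
    show "\<forall>i\<in>?I. \<forall>j\<in>?I. i \<noteq> j \<longrightarrow> ?B i \<inter> ?B j = {}" by (intro ballI impI BB)
  qed
  also have "\<dots> = (\<Sum>i\<in>?I. card (F i))"
    by (intro sum.cong card_image refl) (auto simp: inj_on_def inj_image_eq_iff)
  finally have B: "card (\<Union>i\<in>?I. ?B i) = (\<Sum>i\<in>?I. card (F i))" .
  have A: "card ?A = card R"
    by (intro card_image) (auto simp: inj_on_def inj_image_eq_iff)
  have finB: "finite (\<Union>i\<in>?I. ?B i)" using FD(1) by (simp del: Diff_iff)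
  have "card (graft n (R, F)) = card ?A + card (\<Union>i\<in>?I. ?B i)"
    unfolding graft_def prod.case by (rule card_Un_disjoint[OF finite_imageI[OF finR] finB AB])
  then show ?thesis using A B by simp
qed

subsection \<open>Partitions and Stirling numbers\<close>

lemma partition_on_iff:
  "partition_on A P \<longleftrightarrow> \<Union>P = A \<and> {} \<notin> P \<and> (\<forall>B\<in>P. \<forall>C\<in>P. B \<noteq> C \<longrightarrow> B \<inter> C = {})"
  unfolding partition_on_def disjoint_def by blast

text \<open>Follows the recurrence \<open>Stirling (Suc n) (Suc m) = Suc m * Stirling n (Suc m) +
  Stirling n m\<close>. The new element \<open>a\<close> is a block of its own (\<open>?f\<close>)
  or joins one of the \<open>Suc m\<close> blocks of a partition of \<open>A\<close>
  (\<open>?g\<close>, on pairs of a partition and a chosen block).\<close>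

lemma card_partitions_Stirling:
  "finite A \<Longrightarrow> card {P. partition_on A P \<and> card P = k} = Stirling (card A) k"
proof (induction A arbitrary: k rule: finite_induct)
  case empty
  have eq: "{P. partition_on {} P \<and> card P = k} = (if k = 0 then {{}} else {})"
    by (auto simp: partition_on_empty)
  show ?case unfolding eq by (cases k) simp_all
next
  case (insert a A)
  define parts where "parts X j = {P. partition_on X P \<and> card P = j}" for X :: "'a set" and j
  note [simp] = insert.hyps
  show ?case
  proof (cases k)
    case 0
    have "card P \<noteq> 0" if P: "partition_on (insert a A) P" for P
    proof -
      have "finite P" by (rule finite_elements[OF _ P]) simp
      moreover have "\<Union>P \<noteq> {}" using P unfolding partition_on_iff by blast
      ultimately show ?thesis by auto
    qed
    then have eq: "{P. partition_on (insert a A) P \<and> card P = k} = {}"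
      using 0 by blast
    show ?thesis unfolding eq using 0 by simp
  next
    case (Suc m)
    let ?f = "\<lambda>P. insert {a} P"
    let ?g = "\<lambda>(P, B). insert (insert a B) (P - {B})"
    let ?Sg = "SIGMA P:parts A (Suc m). P"
    have fin: "finite (parts X j)" if "finite X" for X j
      by (rule finite_subset[OF _ finitely_many_partition_on[OF that]]) (auto simp: parts_def)
    have partsI: "P \<in> parts X j" if "\<Union>P = X" "{} \<notin> P"
      "\<And>B C. B \<in> P \<Longrightarrow> C \<in> P \<Longrightarrow> B \<noteq> C \<Longrightarrow> B \<inter> C = {}" "card P = j" for P X j
      unfolding parts_def partition_on_iff using that by blast
    have pD: "finite P" "{} \<notin> P" "\<Union>P = A" "\<And>B C. B \<in> P \<Longrightarrow> C \<in> P \<Longrightarrow> B \<noteq> C \<Longrightarrow> B \<inter> C = {}"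
      "card P = j" "\<And>B. B \<in> P \<Longrightarrow> a \<notin> B" if P: "P \<in> parts A j" for P j
    proof -
      show "finite P" using P finite_elements[OF insert.hyps(1)] unfolding parts_def by blast
      show *: "\<Union>P = A" and "{} \<notin> P" "card P = j" "\<And>B C. B \<in> P \<Longrightarrow> C \<in> P \<Longrightarrow> B \<noteq> C \<Longrightarrow> B \<inter> C = {}"
        using P unfolding parts_def partition_on_iff by blast+
      show "\<And>B. B \<in> P \<Longrightarrow> a \<notin> B" using * insert.hyps(2) by blast
    qed
    have f: "?f P \<in> parts (insert a A) (Suc m)" if "P \<in> parts A m" for P
    proof -
      note D = pD[OF that]
      have new: "{a} \<notin> P" using D(6) by blast
      show ?thesis
      proof (rule partsI)
        show "\<Union>(?f P) = insert a A" using D(3) by simp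
        show "{} \<notin> ?f P" using D(2) by simp
        show "card (?f P) = Suc m" using D(1,5) new by simp
        show "B \<inter> C = {}" if "B \<in> ?f P" "C \<in> ?f P" "B \<noteq> C" for B C
          using that D(4)[of B C] D(6) by blast
      qed
    qed
    have g: "?g (P, B) \<in> parts (insert a A) (Suc m)" if P: "P \<in> parts A (Suc m)" and B: "B \<in> P" for P B
    proof -
      note D = pD[OF P]
      have new: "insert a B \<notin> P - {B}" using D(6) by blast
      have "card (P - {B}) = m" using B D(1,5) by simp
      then have c: "card (?g (P, B)) = Suc m" using new D(1) by simp
      have u: "\<Union>(?g (P, B)) = insert a A" using D(3) B by auto
      have e: "{} \<notin> ?g (P, B)" using D(2) by auto
      have disj: "X \<inter> Y = {}" if "X \<in> ?g (P, B)" "Y \<in> ?g (P, B)" "X \<noteq> Y" for X Y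
      proof -
        have *: "insert a B \<inter> Z = {}" if "Z \<in> P - {B}" for Z
          using D(4)[of B Z] D(6)[of Z] B that by auto
        show ?thesis using that *[of X] *[of Y] D(4)[of X Y] by auto
      qed
      show ?thesis using u e disj c by (rule partsI)
    qed
    have "P \<in> ?f ` parts A m \<union> ?g ` ?Sg" if P: "P \<in> parts (insert a A) (Suc m)" for P
    proof -
      have D: "\<Union>P = insert a A" "{} \<notin> P" "card P = Suc m" "finite P"
        "\<And>B C. B \<in> P \<Longrightarrow> C \<in> P \<Longrightarrow> B \<noteq> C \<Longrightarrow> B \<inter> C = {}"
        using P finite_elements[of "insert a A" P] insert.hyps(1)
        unfolding parts_def partition_on_iff by (blast, blast, blast, simp add: partition_on_iff, blast)
      \<comment> \<open>The block \<open>B\<close> of \<open>a\<close> determines the preimage: drop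
        it if it is \<open>{a}\<close>, otherwise delete \<open>a\<close> from it.\<close>
      obtain B where B: "B \<in> P" "a \<in> B" using D(1) by blast
      have others: "a \<notin> C" if "C \<in> P" "C \<noteq> B" for C using D(5)[OF that(1) B(1) that(2)] B by blast
      have cP: "card (P - {B}) = m" using B(1) D(3,4) by simp
      have Un: "\<Union>(P - {B}) = A - (B - {a})"
      proof (intro equalityI subsetI)
        fix x assume "x \<in> \<Union>(P - {B})"
        then obtain C where C: "C \<in> P" "C \<noteq> B" "x \<in> C" by blast
        have "x \<noteq> a" using others C by blast
        moreover have "x \<notin> B" using D(5)[OF C(1) B(1) C(2)] C by blast
        moreover have "x \<in> insert a A" using C D(1) by blast
        ultimately show "x \<in> A - (B - {a})" by blast
      next
        fix x assume x: "x \<in> A - (B - {a})"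
        then have "x \<in> \<Union>P" "x \<notin> B" using D(1) B insert.hyps(2) by auto
        then show "x \<in> \<Union>(P - {B})" by blast
      qed
      show ?thesis
      proof (cases "B = {a}")
        case True
        have "P - {B} \<in> parts A m"
        proof (rule partsI)
          show "\<Union>(P - {B}) = A" unfolding Un using True by simp
          show "{} \<notin> P - {B}" using D(2) by blast
          show "X \<inter> Y = {}" if "X \<in> P - {B}" "Y \<in> P - {B}" "X \<noteq> Y" for X Y
            using D(5)[of X Y] that by blast
        qed (rule cP)
        moreover have "P = ?f (P - {B})" using B True by blast
        ultimately show ?thesis by blast
      next
        case False
        let ?B = "B - {a}" let ?P = "insert ?B (P - {B})"
        have ne: "?B \<noteq> {}" using False B by blast
        \<comment> \<open>A copy of the shrunken block among the others would meet \<open>B\<close>,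
          so the number of blocks stays \<open>Suc m\<close>.\<close>
        have new: "?B \<notin> P - {B}"
        proof
          assume "?B \<in> P - {B}"
          then have "?B \<inter> B = {}" using D(5)[of ?B B] B by blast
          then show False using ne by blast
        qed
        have "card ?P = Suc m" using new cP D(4) by simp
        moreover have "?B \<union> \<Union>(P - {B}) = A" unfolding Un using B(1) D(1) insert.hyps(2) by blast
        then have "\<Union>?P = A" by simp
        moreover have "X \<inter> Y = {}" if "X \<in> ?P" "Y \<in> ?P" "X \<noteq> Y" for X Y
        proof -
          have *: "?B \<inter> Z = {}" if "Z \<in> P - {B}" for Z
            using D(5)[of B Z] B(1) that by blast
          from that consider "X = ?B" "Y \<in> P - {B}" | "Y = ?B" "X \<in> P - {B}"
            | "X \<in> P" "Y \<in> P" by blast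
          then show ?thesis
          proof cases
            case 1
            then show ?thesis using * by simp
          next
            case 2
            then show ?thesis using * by (simp add: Int_commute)
          qed (use D(5) that(3) in blast)
        qed
        moreover have "{} \<notin> ?P" using D(2) ne by auto
        ultimately have "?P \<in> parts A (Suc m)"
          by (intro partsI)
        moreover have "?P - {?B} = P - {B}" "insert a ?B = B" using new B(2) by blast+
        then have "P = ?g (?P, ?B)" using B(1) by auto
        ultimately have "(?P, ?B) \<in> ?Sg" "P = ?g (?P, ?B)" by blast+
        then show ?thesis by blast
      qed
    qed
    then have eq: "parts (insert a A) (Suc m) = ?f ` parts A m \<union> ?g ` ?Sg"
      using f g by (intro equalityI subsetI) auto
    have disj: "?f ` parts A m \<inter> ?g ` ?Sg = {}"
    proof -
      \<comment> \<open>\<open>{a}\<close> is a block of every \<open>?f P\<close>, but never of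
        \<open>?g (P, B)\<close>, where \<open>a\<close> has joined a nonempty block.\<close>
      have "{a} \<notin> ?g (P, B)" if P: "P \<in> parts A (Suc m)" and B: "B \<in> P" for P B
      proof -
        have "B \<noteq> {}" using pD(2)[OF P] B by blast
        moreover have "a \<notin> B" "{a} \<notin> P" using pD(6)[OF P] B by blast+
        ultimately show ?thesis by auto
      qed
      then show ?thesis by fast
    qed
    have injf: "inj_on ?f (parts A m)"
    proof (rule inj_onI)
      fix P Q assume P: "P \<in> parts A m" and Q: "Q \<in> parts A m" and e: "?f P = ?f Q"
      have "{a} \<notin> P" "{a} \<notin> Q" using pD(6)[OF P] pD(6)[OF Q] by blast+
      then show "P = Q" using e by (metis insert_ident)
    qed
    have injg: "inj_on ?g ?Sg"
    proof (rule inj_onI, clarify)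
      fix P B Q C
      assume P: "P \<in> parts A (Suc m)" "B \<in> P" and Q: "Q \<in> parts A (Suc m)" "C \<in> Q"
        and e: "insert (insert a B) (P - {B}) = insert (insert a C) (Q - {C})"
      have a: "X \<in> P \<Longrightarrow> a \<notin> X" "X \<in> Q \<Longrightarrow> a \<notin> X" for X using pD(6)[OF P(1)] pD(6)[OF Q(1)] by blast+
      \<comment> \<open>The enlarged block is the only one containing \<open>a\<close> on either
        side, so it can be recognised; deleting \<open>a\<close> gives back the chosen block, and
        the remaining blocks agree as well.\<close>
      have "insert a B \<in> insert (insert a C) (Q - {C})" using e by blast
      then have "insert a B = insert a C" using a(2) by blast
      then have BC: "B = C" using a P(2) Q(2) by (metis insert_ident)
      have "insert a B \<notin> P - {B}" "insert a B \<notin> Q - {C}" using a by blast+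
      then have "P - {B} = Q - {C}" using e BC by (metis insert_ident)
      then show "P = Q \<and> B = C" using BC P(2) Q(2) by blast
    qed
    have "card (parts (insert a A) (Suc m)) = card (?f ` parts A m) + card (?g ` ?Sg)"
      unfolding eq using fin[OF insert.hyps(1)] pD(1) disj
      by (intro card_Un_disjoint finite_imageI finite_SigmaI) blast+
    also have "card (?f ` parts A m) = card (parts A m)" using injf by (rule card_image)
    also have "card (?g ` ?Sg) = card ?Sg" using injg by (rule card_image)
    also have "card ?Sg = (\<Sum>P\<in>parts A (Suc m). card P)"
      using fin[OF insert.hyps(1)] pD(1) by (intro card_SigmaI) blast+
    also have "\<dots> = (\<Sum>P\<in>parts A (Suc m). Suc m)"
      using pD(5) by (intro sum.cong refl) blast
    finally show ?thesis using insert.IH Suc by (simp add: parts_def)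
  qed
qed

subsection \<open>Colourings up to recolouring\<close>

text \<open>Each class is the fibre of \<open>f\<close> over one attained value, and distinct
  attained values have distinct fibres. The resulting bijection gives equal \<open>card\<close> for
  infinite quotients too.\<close>

lemma card_quotient_kernel:
  assumes "equiv D r" and ker: "\<And>x y. x \<in> D \<Longrightarrow> y \<in> D \<Longrightarrow> (x, y) \<in> r \<longleftrightarrow> f x = f y"
  shows "card (D // r) = card (f ` D)"
proof -
  let ?h = "\<lambda>z. {y \<in> D. f y = z}"
  have "r `` {x} = ?h (f x)" if x: "x \<in> D" for x
  proof -
    have "r `` {x} \<subseteq> D" using assms(1) by (auto simp: equiv_def refl_on_def)
    then show ?thesis using ker[OF x] by auto
  qed
  then have "D // r = ?h ` f ` D" by (auto simp: quotient_def)
  moreover have "inj_on ?h (f ` D)" by (rule inj_onI) blast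
  ultimately show ?thesis by (simp add: card_image)
qed

definition colour_classes :: "nat \<Rightarrow> 'a set \<times> ('a \<Rightarrow> nat) \<Rightarrow> 'a set set" where
  "colour_classes k = (\<lambda>(S, c). (\<lambda>i. {p \<in> S. c p = i}) ` {..<k})"

text \<open>With \<open>[] \<notin> S\<close> all words are nonempty, so siblings can be recognised
  by \<open>butlast\<close>. The condition \<open>p \<noteq> q\<close> then disappears, as equality
  of the parents is trivial for \<open>p = q\<close>.\<close>

lemma lower_dsc_iff:
  "(S, c) \<in> lower_dsc n k \<longleftrightarrow> maximal_antichain (nary_tree n) S \<and> [] \<notin> S \<and>
     c \<in> S \<rightarrow>\<^sub>E {..<k} \<and> c ` S = {..<k} \<and> (\<forall>p\<in>S. \<forall>q\<in>S. c p = c q \<longrightarrow> butlast p = butlast q)"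
proof (cases "maximal_antichain (nary_tree n) S \<and> [] \<notin> S")
  case True
  then have S: "p \<in> lists {..<n}" "p \<noteq> []" if "p \<in> S" for p
    using that by (auto simp: maximal_antichain_nary_tree)
  have "(p \<noteq> q \<and> c p = c q \<longrightarrow> siblings (nary_tree n) p q) \<longleftrightarrow> (c p = c q \<longrightarrow> butlast p = butlast q)"
    if "p \<in> S" "q \<in> S" for p q
    using siblings_nary_tree[OF S(1)[OF that(1)] S(1)[OF that(2)] S(2)[OF that(1)] S(2)[OF that(2)]]
    by blast
  then show ?thesis using True maximal_antichain_Nil_iff[of n S] by (auto simp: lower_dsc_def dsc_def)
qed (auto simp: lower_dsc_def dsc_def maximal_antichain_Nil_iff)

lemma colour_classes_in_lower_partitions:
  assumes "(S, c) \<in> lower_dsc n k"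
  shows "colour_classes k (S, c) \<in> lower_partitions n" "card (colour_classes k (S, c)) = k"
    "\<Union>(colour_classes k (S, c)) = S"
proof -
  have S: "maximal_antichain (nary_tree n) S" "[] \<notin> S" "c ` S = {..<k}"
    "\<And>p q. p \<in> S \<Longrightarrow> q \<in> S \<Longrightarrow> c p = c q \<Longrightarrow> butlast p = butlast q"
    using assms unfolding lower_dsc_iff by blast+
  let ?P = "colour_classes k (S, c)"
  show Un: "\<Union>?P = S" using S(3) by (auto simp: colour_classes_def)
  \<comment> \<open>Every colour below \<open>k\<close> is attained, so distinct colours have
    distinct classes and there are exactly \<open>k\<close> of them.\<close>
  have "inj_on (\<lambda>i. {p \<in> S. c p = i}) {..<k}"
  proof (rule inj_onI)
    fix i j assume "i \<in> {..<k}" and e: "{p \<in> S. c p = i} = {p \<in> S. c p = j}"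
    then obtain p where "p \<in> S" "c p = i" using S(3) by (metis imageE)
    then show "i = j" using e by blast
  qed
  then show "card ?P = k" by (simp add: colour_classes_def card_image)
  have "finite ?P" by (simp add: colour_classes_def)
  moreover have "{} \<notin> ?P"
  proof
    assume "{} \<in> ?P"
    then obtain i where "i < k" "{p \<in> S. c p = i} = {}" by (auto simp: colour_classes_def)
    then have "i \<notin> c ` S" by blast
    then show False using S(3) \<open>i < k\<close> by simp
  qed
  then have "partition_on S ?P" using Un
    by (auto simp: partition_on_def disjoint_def colour_classes_def)
  moreover have "\<forall>B\<in>?P. \<forall>p\<in>B. \<forall>q\<in>B. butlast p = butlast q"
  proof (intro ballI)
    fix B p q assume "B \<in> ?P" "p \<in> B" "q \<in> B"
    then have "p \<in> S" "q \<in> S" "c p = c q" by (auto simp: colour_classes_def)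
    then show "butlast p = butlast q" by (rule S(4))
  qed
  ultimately show "?P \<in> lower_partitions n"
    unfolding lower_partitions_def mem_Collect_eq Un using S(1,2) by blast
qed

text \<open>Equal classes mean that \<open>c\<close> and \<open>d\<close> identify the same pairs of
  points, so sending the colour \<open>c p\<close> to \<open>d p\<close> is well defined and
  injective on the finite colour set. Conversely, a permutation only reindexes the family of
  classes.\<close>

lemma colour_classes_eq_iff:
  assumes "c ` S = {..<k}" "d ` S = {..<k}"
  shows "colour_classes k (S, c) = colour_classes k (S, d) \<longleftrightarrow>
    (\<exists>\<pi>. \<pi> permutes {..<k} \<and> (\<forall>p\<in>S. d p = \<pi> (c p)))"
proof
  assume eq: "colour_classes k (S, c) = colour_classes k (S, d)"
  have cls: "e p = e q \<longleftrightarrow> (\<exists>B\<in>colour_classes k (S, e). p \<in> B \<and> q \<in> B)"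
    if "e ` S = {..<k}" "p \<in> S" "q \<in> S" for p q e
    using that by (auto simp: colour_classes_def)
  have cd: "c p = c q \<longleftrightarrow> d p = d q" if "p \<in> S" "q \<in> S" for p q
    using cls[OF assms(1) that] cls[OF assms(2) that] eq by simp
  \<comment> \<open>The value at a colour \<open>i\<close> is the \<open>d\<close>-colour of some
    point with \<open>c\<close>-colour \<open>i\<close>; the identity outside the colour set is what
    \<open>permutes\<close> demands.\<close>
  define \<pi> where "\<pi> i = (if i < k then d (inv_into S c i) else i)" for i
  have inv: "inv_into S c i \<in> S" "c (inv_into S c i) = i" if "i < k" for i
    using that assms(1) inv_into_into[of i c S] f_inv_into_f[of i c S] by simp_all
  have "inj_on \<pi> {..<k}"
  proof (rule inj_onI)
    fix i j assume "i \<in> {..<k}" "j \<in> {..<k}" and e: "\<pi> i = \<pi> j"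
    then have ij: "i < k" "j < k" by simp_all
    have "c (inv_into S c i) = c (inv_into S c j)"
      using cd[OF inv(1)[OF ij(1)] inv(1)[OF ij(2)]] e ij by (simp add: \<pi>_def)
    then show "i = j" using inv(2) ij by simp
  qed
  moreover have "\<pi> ` {..<k} \<subseteq> {..<k}"
    using inv(1) assms(2) by (auto simp: \<pi>_def)
  ultimately have "bij_betw \<pi> {..<k} {..<k}"
    by (simp add: bij_betw_def endo_inj_surj)
  then have "\<pi> permutes {..<k}" by (rule bij_imp_permutes) (simp add: \<pi>_def)
  moreover have "d p = \<pi> (c p)" if p: "p \<in> S" for p
  proof -
    have "c p < k" using p assms(1) by blast
    then have "d p = d (inv_into S c (c p))" using cd[OF p inv(1)] inv(2) by metis
    then show ?thesis using \<open>c p < k\<close> by (simp add: \<pi>_def)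
  qed
  ultimately show "\<exists>\<pi>. \<pi> permutes {..<k} \<and> (\<forall>p\<in>S. d p = \<pi> (c p))" by blast
next
  assume "\<exists>\<pi>. \<pi> permutes {..<k} \<and> (\<forall>p\<in>S. d p = \<pi> (c p))"
  then obtain \<pi> where \<pi>: "\<pi> permutes {..<k}" "\<And>p. p \<in> S \<Longrightarrow> d p = \<pi> (c p)" by blast
  have "colour_classes k (S, d) = (\<lambda>i. {p \<in> S. d p = i}) ` \<pi> ` {..<k}"
    by (simp add: colour_classes_def permutes_image[OF \<pi>(1)])
  also have "\<dots> = (\<lambda>i. {p \<in> S. d p = \<pi> i}) ` {..<k}" by (simp add: image_image)
  also have "\<dots> = colour_classes k (S, c)"
  proof -
    have "{p \<in> S. d p = \<pi> i} = {p \<in> S. c p = i}" for i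
      using \<pi>(2) permutes_inj[OF \<pi>(1)] by (auto simp: inj_eq)
    then show ?thesis by (simp add: colour_classes_def)
  qed
  finally show "colour_classes k (S, c) = colour_classes k (S, d)" by simp
qed

lemma colour_classes_surj:
  assumes P: "P \<in> lower_partitions n" and k: "card P = k"
  shows "P \<in> colour_classes k ` lower_dsc n k"
proof -
  note PD = lower_partitionsD[OF P]
  obtain h where h: "bij_betw h {..<k} P"
    using ex_bij_betw_nat_finite[OF PD(1)] k by (auto simp: lessThan_atLeast0)
  have hP: "h i \<in> P" if "i < k" for i using h that by (auto simp: bij_betw_def)
  \<comment> \<open>A point gets the number of its block under \<open>h\<close>, unique because
    blocks are disjoint. Restriction to \<open>\<Union>P\<close> makes the colouring extensional, as
    \<open>dsc\<close> requires.\<close>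
  define c where "c = (\<lambda>p\<in>\<Union>P. THE i. i < k \<and> p \<in> h i)"
  have c: "c p = i" if "i < k" "p \<in> h i" for i p
  proof -
    have "j = i" if "j < k" "p \<in> h j" for j
    proof (rule ccontr)
      assume "j \<noteq> i"
      then have "h j \<noteq> h i" using h that(1) \<open>i < k\<close> by (auto simp: bij_betw_def inj_on_def)
      then show False using PD(6)[OF hP[OF that(1)] hP[OF \<open>i < k\<close>]] that(2) \<open>p \<in> h i\<close> by blast
    qed
    then have "(THE i. i < k \<and> p \<in> h i) = i" using that by (intro the_equality) blast+
    moreover have "p \<in> \<Union>P" using hP that by blast
    ultimately show ?thesis by (simp add: c_def)
  qed
  have ex: "\<exists>i<k. p \<in> h i" if p: "p \<in> \<Union>P" for p
  proof -
    obtain B where "B \<in> P" "p \<in> B" using p by blast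
    then show ?thesis using h by (auto simp: bij_betw_def)
  qed
  have cls: "{p \<in> \<Union>P. c p = i} = h i" if i: "i < k" for i
  proof (intro equalityI subsetI)
    fix p assume "p \<in> {p \<in> \<Union>P. c p = i}"
    then obtain j where "j < k" "p \<in> h j" "c p = i" using ex by blast
    then show "p \<in> h i" using c by blast
  next
    fix p assume "p \<in> h i"
    then show "p \<in> {p \<in> \<Union>P. c p = i}" using c hP i by blast
  qed
  have cc: "colour_classes k (\<Union>P, c) = P"
  proof -
    have "colour_classes k (\<Union>P, c) = h ` {..<k}" using cls by (auto simp: colour_classes_def)
    then show ?thesis using h by (simp add: bij_betw_def)
  qed
  have lt: "c p < k" if "p \<in> \<Union>P" for p using ex[OF that] c by blast
  have "c \<in> \<Union>P \<rightarrow>\<^sub>E {..<k}" using lt by (simp add: PiE_iff c_def)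
  moreover have "c ` \<Union>P = {..<k}"
  proof (intro equalityI subsetI)
    fix i assume i: "i \<in> {..<k}"
    then have "h i \<in> P" using hP by simp
    then obtain p where p: "p \<in> h i" using PD(4) by (metis all_not_in_conv)
    then have "c p = i" "p \<in> \<Union>P" using c \<open>h i \<in> P\<close> i by blast+
    then show "i \<in> c ` \<Union>P" by blast
  qed (use lt in auto)
  moreover have "butlast p = butlast q" if "p \<in> \<Union>P" "q \<in> \<Union>P" "c p = c q" for p q
  proof (rule PD(7)[OF hP[OF lt[OF that(1)]]])
    show "p \<in> h (c p)" "q \<in> h (c p)"
      unfolding cls[OF lt[OF that(1)], symmetric] using that by simp_all
  qed
  ultimately have "(\<Union>P, c) \<in> lower_dsc n k" unfolding lower_dsc_iff using PD(2,3) by blast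
  then show ?thesis using cc by (metis imageI)
qed

text \<open>Two sweep covers are recolourings of each other exactly when
  \<open>colour_classes k\<close> agrees on them, and its values are precisely the lower partitions
  with \<open>k\<close> blocks.\<close>

lemma lower_dsc_count_eq_card_lower_partitions:
  "lower_dsc_count n k = card {P \<in> lower_partitions n. card P = k}"
proof -
  have ker: "(x, y) \<in> recolouring (lower_dsc n k) k \<longleftrightarrow> colour_classes k x = colour_classes k y"
    if xy: "x \<in> lower_dsc n k" "y \<in> lower_dsc n k" for x y
  proof -
    obtain S c T d where e: "x = (S, c)" "y = (T, d)" by (cases x; cases y)
    show ?thesis
    proof (cases "S = T")
      case True
      have "c ` S = {..<k}" "d ` S = {..<k}" using xy True unfolding e lower_dsc_iff by blast+
      from colour_classes_eq_iff[OF this] show ?thesis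
        using xy True unfolding e recolouring_def by simp
    next
      \<comment> \<open>The antichain is the union of the colour classes, so different antichains
        have different classes.\<close>
      case False
      then show ?thesis
        using colour_classes_in_lower_partitions(3)[OF xy(1)[unfolded e]]
          colour_classes_in_lower_partitions(3)[OF xy(2)[unfolded e]]
        unfolding e recolouring_def by auto
    qed
  qed
  have "colour_classes k ` lower_dsc n k = {P \<in> lower_partitions n. card P = k}"
  proof (intro equalityI subsetI)
    fix P assume "P \<in> colour_classes k ` lower_dsc n k"
    then obtain S c where "(S, c) \<in> lower_dsc n k" "P = colour_classes k (S, c)" by (metis imageE surj_pair)
    then show "P \<in> {P \<in> lower_partitions n. card P = k}"
      using colour_classes_in_lower_partitions(1,2) by blast
  qed (use colour_classes_surj in blast)
  then show ?thesis
    unfolding lower_dsc_count_def using card_quotient_kernel[OF equiv_recolouring ker] by simp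
qed

subsection \<open>The recurrence\<close>

text \<open>The form \<open>a + sum \<kappa> I = k\<close> avoids the truncated difference
  \<open>k - a\<close>, which for empty \<open>I\<close> would admit the empty tuple also when
  \<open>a > k\<close>. The index set is arbitrary because the letters outside the root blocks need
  not form an interval.\<close>

definition weight_tuples :: "nat \<Rightarrow> 'i set \<Rightarrow> nat \<Rightarrow> ('i \<Rightarrow> nat) set" where
  "weight_tuples a I k = {\<kappa>. \<kappa> \<in> I \<rightarrow>\<^sub>E {1..} \<and> a + sum \<kappa> I = k}"

lemma finite_weight_tuples:
  assumes "finite I"
  shows "finite (weight_tuples a I k)"
proof (rule finite_subset)
  show "weight_tuples a I k \<subseteq> I \<rightarrow>\<^sub>E {..k}"
  proof
    fix \<kappa> assume \<kappa>: "\<kappa> \<in> weight_tuples a I k"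
    have "\<kappa> i \<le> k" if "i \<in> I" for i
      using member_le_sum[OF that, of \<kappa>] assms \<kappa> by (simp add: weight_tuples_def)
    then show "\<kappa> \<in> I \<rightarrow>\<^sub>E {..k}" using \<kappa> by (auto simp: weight_tuples_def PiE_iff)
  qed
  show "finite (I \<rightarrow>\<^sub>E {..k})" using assms by (simp add: finite_PiE)
qed

text \<open>Sorts the functions by the tuple of weights of their values: those with tuple
  \<open>\<kappa>\<close> form a product of level sets, and different tuples give disjoint
  products.\<close>

lemma card_PiE_weight:
  fixes wt :: "'b \<Rightarrow> nat"
  assumes I: "finite I" and pos: "\<And>x. x \<in> L \<Longrightarrow> wt x \<ge> 1"
    and fin: "\<And>j. finite {x \<in> L. wt x = j}"
  shows "card {F \<in> I \<rightarrow>\<^sub>E L. a + (\<Sum>i\<in>I. wt (F i)) = k} =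
    (\<Sum>\<kappa>\<in>weight_tuples a I k. \<Prod>i\<in>I. card {x \<in> L. wt x = \<kappa> i})"
proof -
  let ?T = "\<lambda>\<kappa>. \<Pi>\<^sub>E i\<in>I. {x \<in> L. wt x = \<kappa> i}"
  have "{F \<in> I \<rightarrow>\<^sub>E L. a + (\<Sum>i\<in>I. wt (F i)) = k} = (\<Union>\<kappa>\<in>weight_tuples a I k. ?T \<kappa>)"
  proof (intro equalityI subsetI)
    fix F assume F: "F \<in> {F \<in> I \<rightarrow>\<^sub>E L. a + (\<Sum>i\<in>I. wt (F i)) = k}"
    let ?\<kappa> = "\<lambda>i\<in>I. wt (F i)"
    have "?\<kappa> \<in> weight_tuples a I k"
      using F pos by (auto simp: weight_tuples_def PiE_iff)
    moreover have "F \<in> ?T ?\<kappa>" using F by (auto simp: PiE_iff)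
    ultimately show "F \<in> (\<Union>\<kappa>\<in>weight_tuples a I k. ?T \<kappa>)" by (rule UN_I[where B = ?T])
  next
    fix F assume "F \<in> (\<Union>\<kappa>\<in>weight_tuples a I k. ?T \<kappa>)"
    then obtain \<kappa> where \<kappa>: "\<kappa> \<in> weight_tuples a I k" and F: "F \<in> ?T \<kappa>" by (rule UN_E)
    have "(\<Sum>i\<in>I. wt (F i)) = sum \<kappa> I" using F by (intro sum.cong) (auto simp: PiE_iff)
    then show "F \<in> {F \<in> I \<rightarrow>\<^sub>E L. a + (\<Sum>i\<in>I. wt (F i)) = k}"
      using \<kappa> F by (auto simp: weight_tuples_def PiE_iff)
  qed
  also have "card \<dots> = (\<Sum>\<kappa>\<in>weight_tuples a I k. card (?T \<kappa>))"
  proof (rule card_UN_disjoint)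
    show "finite (weight_tuples a I k)" using I by (rule finite_weight_tuples)
    show "\<forall>\<kappa>\<in>weight_tuples a I k. finite (?T \<kappa>)" using I fin by (auto intro!: finite_PiE)
    show "\<forall>\<kappa>\<in>weight_tuples a I k. \<forall>\<mu>\<in>weight_tuples a I k. \<kappa> \<noteq> \<mu> \<longrightarrow> ?T \<kappa> \<inter> ?T \<mu> = {}"
    proof (intro ballI impI equals0I)
      fix \<kappa> \<mu> F
      assume km: "\<kappa> \<in> weight_tuples a I k" "\<mu> \<in> weight_tuples a I k" "\<kappa> \<noteq> \<mu>" and F: "F \<in> ?T \<kappa> \<inter> ?T \<mu>"
      have "\<kappa> i = \<mu> i" if "i \<in> I" for i using F that by (auto simp: PiE_iff)
      moreover have "\<kappa> \<in> I \<rightarrow>\<^sub>E {1..}" "\<mu> \<in> I \<rightarrow>\<^sub>E {1..}" using km by (simp_all add: weight_tuples_def)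
      ultimately have "\<kappa> = \<mu>" by (intro PiE_ext)
      then show False using km(3) by simp
    qed
  qed
  also have "\<dots> = (\<Sum>\<kappa>\<in>weight_tuples a I k. \<Prod>i\<in>I. card {x \<in> L. wt x = \<kappa> i})"
    using I by (simp add: card_PiE)
  finally show ?thesis .
qed

text \<open>Relabelling along \<open>h\<close> transports the tuples. It serves to replace the
  remaining letters by \<open>{1..n-u}\<close>, so that only their number matters.\<close>

lemma sum_weight_tuples_reindex:
  fixes g :: "nat \<Rightarrow> 'c :: comm_semiring_1"
  assumes h: "bij_betw h J I"
  shows "(\<Sum>\<kappa>\<in>weight_tuples a I k. \<Prod>i\<in>I. g (\<kappa> i)) = (\<Sum>\<kappa>\<in>weight_tuples a J k. \<Prod>j\<in>J. g (\<kappa> j))"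
proof (rule sum.reindex_bij_witness[where i = "\<lambda>\<kappa>. \<lambda>i\<in>I. \<kappa> (inv_into J h i)" and j = "\<lambda>\<kappa>. \<lambda>j\<in>J. \<kappa> (h j)"])
  note inv = bij_betw_inv_into[OF h]
  have hI: "h j \<in> I" "inv_into J h (h j) = j" if "j \<in> J" for j
    using that h bij_betw_inv_into_left[OF h] by (auto simp: bij_betw_def)
  have hJ: "inv_into J h i \<in> J" "h (inv_into J h i) = i" if "i \<in> I" for i
    using that inv bij_betw_inv_into_right[OF h] by (auto simp: bij_betw_def)
  show "(\<lambda>i\<in>I. (\<lambda>j\<in>J. \<kappa> (h j)) (inv_into J h i)) = \<kappa>" if "\<kappa> \<in> weight_tuples a I k" for \<kappa>
    using that hJ by (intro ext) (auto simp: weight_tuples_def PiE_iff extensional_def restrict_def)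
  show "(\<lambda>j\<in>J. (\<lambda>i\<in>I. \<kappa> (inv_into J h i)) (h j)) = \<kappa>" if "\<kappa> \<in> weight_tuples a J k" for \<kappa>
    using that hI by (intro ext) (auto simp: weight_tuples_def PiE_iff extensional_def restrict_def)
  show "(\<lambda>j\<in>J. \<kappa> (h j)) \<in> weight_tuples a J k" if "\<kappa> \<in> weight_tuples a I k" for \<kappa>
    using that hI sum.reindex_bij_betw[OF h, of \<kappa>] by (auto simp: weight_tuples_def PiE_iff)
  show "(\<lambda>i\<in>I. \<kappa> (inv_into J h i)) \<in> weight_tuples a I k" if "\<kappa> \<in> weight_tuples a J k" for \<kappa>
    using that hJ sum.reindex_bij_betw[OF inv, of \<kappa>] by (auto simp: weight_tuples_def PiE_iff)
  show "(\<Prod>j\<in>J. g ((\<lambda>j\<in>J. \<kappa> (h j)) j)) = (\<Prod>i\<in>I. g (\<kappa> i))" if "\<kappa> \<in> weight_tuples a I k" for \<kappa>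
    using prod.reindex_bij_betw[OF h, of "\<lambda>i. g (\<kappa> i)"] by simp
qed

section \<open>Finiteness for a fixed number of blocks\<close>

lemma finite_root_partitions: "finite (root_partitions n)"
  by (rule finite_subset[of _ "Pow (Pow {..<n})"]) (auto simp: root_partitions_def)

lemma card_lower_partition_pos:
  assumes "P \<in> lower_partitions n"
  shows "card P \<ge> 1"
  using lower_partitionsD(1,5)[OF assms] by (simp add: Suc_le_eq card_gt_0_iff)

lemma graft_domainD:
  assumes "(R, F) \<in> graft_domain n"
  shows "R \<in> root_partitions n" "F \<in> ({..<n} - \<Union>R) \<rightarrow>\<^sub>E lower_partitions n"
  using assms by (simp_all add: graft_domain_def)

text \<open>Besides the given piece there is a block at the root or, since \<open>n \<ge> 2\<close>, another piece.\<close>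

lemma card_piece_less_card_graft:
  assumes n: "n \<ge> 2" and dom: "(R, F) \<in> graft_domain n" and i: "i \<in> {..<n} - \<Union>R"
  shows "card (F i) < card (graft n (R, F))"
proof -
  let ?I = "{..<n} - \<Union>R"
  have pos: "card (F j) \<ge> 1" if "j \<in> ?I" for j
    using PiE_mem[OF graft_domainD(2)[OF dom] that] by (rule card_lower_partition_pos)
  have sum: "(\<Sum>j\<in>?I. card (F j)) = card (F i) + (\<Sum>j\<in>?I - {i}. card (F j))"
    using i by (intro sum.remove) auto
  show ?thesis
  proof (cases "R = {}")
    case True
    define j where "j = (if i = 0 then 1 else 0 :: nat)"
    have j: "j \<in> ?I - {i}" using n True by (auto simp: j_def)
    have "card (F j) \<le> (\<Sum>j\<in>?I - {i}. card (F j))"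
      using j by (intro member_le_sum) auto
    then show ?thesis using pos[of j] j sum card_graft[OF dom] by simp
  next
    case False
    have "\<Union>R \<subseteq> {..<n}" using graft_domainD(1)[OF dom] by (simp add: root_partitions_def)
    from finite_UnionD[OF finite_subset[OF this finite_lessThan]] False
    have "card R > 0" by (simp add: card_gt_0_iff)
    then show ?thesis using sum card_graft[OF dom] by linarith
  qed
qed

text \<open>By strong induction on \<open>k\<close>, the grafted pieces, having fewer blocks than
  the whole, come from the finite set \<open>Q\<close>, so there are finitely many grafts. For
  \<open>n = 1\<close> this fails, since a chain has infinitely many one-element maximal
  antichains.\<close>

lemma finite_lower_partitions_card:
  assumes n: "n \<ge> 2"
  shows "finite {P \<in> lower_partitions n. card P = k}"
proof (induction k rule: less_induct)
  case (less k)
  define Q where "Q = (\<Union>j<k. {P \<in> lower_partitions n. card P = j})"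
  have "finite Q" using less by (simp add: Q_def)
  then have fin: "finite (SIGMA R:root_partitions n. ({..<n} - \<Union>R) \<rightarrow>\<^sub>E Q)"
    using finite_root_partitions by (intro finite_SigmaI finite_PiE) auto
  have "{P \<in> lower_partitions n. card P = k} \<subseteq> graft n ` (SIGMA R:root_partitions n. ({..<n} - \<Union>R) \<rightarrow>\<^sub>E Q)"
  proof
    fix P assume "P \<in> {P \<in> lower_partitions n. card P = k}"
    then have P: "P \<in> lower_partitions n" "card P = k" by simp_all
    have "n > 0" using n by simp
    then have "P \<in> graft n ` graft_domain n" using P(1) by (rule graft_surj)
    then obtain R F where RF: "P = graft n (R, F)" "(R, F) \<in> graft_domain n" by (metis imageE surj_pair)
    note D = graft_domainD[OF RF(2)]
    have "F i \<in> Q" if "i \<in> {..<n} - \<Union>R" for i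
      using PiE_mem[OF D(2) that] card_piece_less_card_graft[OF n RF(2) that] RF(1) P(2)
      by (simp add: Q_def)
    then have "F \<in> ({..<n} - \<Union>R) \<rightarrow>\<^sub>E Q" using D(2) by (simp add: PiE_iff)
    then show "P \<in> graft n ` (SIGMA R:root_partitions n. ({..<n} - \<Union>R) \<rightarrow>\<^sub>E Q)"
      using D(1) RF(1) by (intro image_eqI[of _ _ "(R, F)"]) simp_all
  qed
  then show ?case by (rule finite_subset) (use fin in simp)
qed

section \<open>Grouping root partitions by size and number of blocks\<close>

lemma sum_group_card:
  fixes w :: "nat \<Rightarrow> nat"
  assumes "finite A" "\<And>x. x \<in> A \<Longrightarrow> card x \<le> m"
  shows "(\<Sum>x\<in>A. w (card x)) = (\<Sum>j=0..m. card {x \<in> A. card x = j} * w j)"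
proof -
  have "(\<Sum>x\<in>A. w (card x)) = (\<Sum>j=0..m. \<Sum>x | x \<in> A \<and> card x = j. w (card x))"
    using assms by (intro sum.group[symmetric]) auto
  also have "\<dots> = (\<Sum>j=0..m. card {x \<in> A. card x = j} * w j)"
    by (intro sum.cong refl) simp
  finally show ?thesis .
qed

text \<open>Root partitions are grouped by their union \<open>U\<close> and then by the number of
  blocks, which gives \<open>Stirling (card U) j\<close>; grouping the sets \<open>U\<close> by size
  gives \<open>n choose u\<close>.\<close>

lemma sum_root_partitions:
  fixes w :: "nat \<Rightarrow> nat \<Rightarrow> nat"
  shows "(\<Sum>R\<in>root_partitions n. w (card (\<Union>R)) (card R)) =
    (\<Sum>u=0..n. \<Sum>j=0..u. (n choose u) * Stirling u j * w u j)"
proof -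
  have "(\<Sum>R\<in>root_partitions n. w (card (\<Union>R)) (card R)) =
      (\<Sum>U\<in>Pow {..<n}. \<Sum>R | R \<in> root_partitions n \<and> \<Union>R = U. w (card (\<Union>R)) (card R))"
    using finite_root_partitions by (intro sum.group[symmetric]) (auto simp: root_partitions_def)
  also have "\<dots> = (\<Sum>U\<in>Pow {..<n}. \<Sum>j=0..card U. Stirling (card U) j * w (card U) j)"
  proof (intro sum.cong refl)
    fix U :: "nat set" assume U: "U \<in> Pow {..<n}"
    then have fU: "finite U" by (auto intro: finite_subset)
    have eq: "{R. R \<in> root_partitions n \<and> \<Union>R = U} = {R. partition_on U R}"
      using U by (auto simp: root_partitions_def partition_on_iff)
    \<comment> \<open>Blocks are nonempty and disjoint, so there are at most as many as points; this
      is why \<open>j\<close> stops at \<open>card U\<close>.\<close>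
    have le: "card R \<le> card U" if R: "partition_on U R" for R
    proof -
      have fin: "finite B" if "B \<in> R" for B
        using fU R that by (auto simp: partition_on_iff intro: finite_subset)
      have "card R = (\<Sum>B\<in>R. 1)" by simp
      also have "\<dots> \<le> (\<Sum>B\<in>R. card B)"
        using fin R by (intro sum_mono) (auto simp: partition_on_iff Suc_le_eq card_gt_0_iff)
      also have "\<dots> = card (\<Union>R)"
        using fin partition_onD2[OF R] by (intro card_Union_disjoint[symmetric])
      finally show ?thesis using partition_onD1[OF R] by simp
    qed
    have "(\<Sum>R | R \<in> root_partitions n \<and> \<Union>R = U. w (card (\<Union>R)) (card R)) =
        (\<Sum>R | partition_on U R. w (card U) (card R))"
      unfolding eq by (intro sum.cong refl) (simp add: partition_on_iff)
    also have "\<dots> = (\<Sum>j=0..card U. card {R \<in> {R. partition_on U R}. card R = j} * w (card U) j)"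
      using finitely_many_partition_on[OF fU] le by (intro sum_group_card) auto
    also have "\<dots> = (\<Sum>j=0..card U. Stirling (card U) j * w (card U) j)"
      using card_partitions_Stirling[OF fU] by simp
    finally show "(\<Sum>R | R \<in> root_partitions n \<and> \<Union>R = U. w (card (\<Union>R)) (card R)) =
      (\<Sum>j=0..card U. Stirling (card U) j * w (card U) j)" .
  qed
  also have "\<dots> = (\<Sum>u=0..n. card {U \<in> Pow {..<n}. card U = u} * (\<Sum>j=0..u. Stirling u j * w u j))"
  proof (rule sum_group_card)
    fix U assume "U \<in> Pow {..<n}"
    then show "card U \<le> n" using card_mono[of "{..<n}" U] by simp
  qed simp
  also have "\<dots> = (\<Sum>u=0..n. \<Sum>j=0..u. (n choose u) * Stirling u j * w u j)"
    using n_subsets[of "{..<n}"] by (simp add: sum_distrib_left mult.assoc)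
  finally show ?thesis .
qed

theorem lemma7:
  fixes n k :: nat
  assumes "n \<ge> 2"
  shows "lower_dsc_count n k =
    (\<Sum>u=0..n. \<Sum>k'=0..u. (n choose u) * Stirling u k' *
      (\<Sum>\<kappa> | \<kappa> \<in> {1..n-u} \<rightarrow>\<^sub>E {1..} \<and> k' + (\<Sum>j=1..n-u. \<kappa> j) = k.
        \<Prod>j=1..n-u. lower_dsc_count n (\<kappa> j)))"
proof -
  let ?L = "lower_partitions n"
  let ?c = "\<lambda>j. card {P \<in> ?L. card P = j}"
  define w where "w u k' = (\<Sum>\<kappa>\<in>weight_tuples k' {1..n-u} k. \<Prod>j=1..n-u. ?c (\<kappa> j))" for u k'
  \<comment> \<open>By \<open>card_graft\<close>, these are the families of pieces that complete the
    root blocks \<open>R\<close> to a partition with exactly \<open>k\<close> blocks.\<close>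
  define T where "T R = {F \<in> ({..<n} - \<Union>R) \<rightarrow>\<^sub>E ?L. card R + (\<Sum>i\<in>{..<n} - \<Union>R. card (F i)) = k}" for R
  have fin: "finite {P \<in> ?L. card P = j}" for j
    using assms by (rule finite_lower_partitions_card)
  have graft: "inj_on (graft n) (graft_domain n)" "graft n ` graft_domain n = ?L"
    using bij_betw_graft[of n] assms by (simp_all add: bij_betw_def)
  have "{P \<in> ?L. card P = k} = graft n ` (SIGMA R:root_partitions n. T R)"
  proof (intro equalityI subsetI)
    fix P assume "P \<in> {P \<in> ?L. card P = k}"
    then have P: "P \<in> graft n ` graft_domain n" "card P = k" using graft(2) by simp_all
    then obtain R F where RF: "P = graft n (R, F)" "(R, F) \<in> graft_domain n" by (metis imageE surj_pair)
    have "(R, F) \<in> (SIGMA R:root_partitions n. T R)"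
      using graft_domainD[OF RF(2)] card_graft[OF RF(2)] RF(1) P(2) by (simp add: T_def)
    then show "P \<in> graft n ` (SIGMA R:root_partitions n. T R)" using RF(1) by (rule rev_image_eqI)
  next
    fix P assume "P \<in> graft n ` (SIGMA R:root_partitions n. T R)"
    then obtain R F where RF: "P = graft n (R, F)" "R \<in> root_partitions n" "F \<in> T R" by auto
    then have d: "(R, F) \<in> graft_domain n" by (simp add: graft_domain_def T_def)
    then have "P \<in> ?L" using RF(1) graft(2) by blast
    then show "P \<in> {P \<in> ?L. card P = k}" using RF card_graft[OF d] by (simp add: T_def)
  qed
  moreover have sub: "(SIGMA R:root_partitions n. T R) \<subseteq> graft_domain n"
    by (auto simp: graft_domain_def T_def)
  ultimately have eq: "?c k = card (SIGMA R:root_partitions n. T R)"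
    using inj_on_subset[OF graft(1)] by (simp add: card_image)
  \<comment> \<open>\<open>lower_partitions n\<close> itself is infinite, so finiteness of each
    \<open>T R\<close>, needed for \<open>card_SigmaI\<close>, is drawn from the partitions with
    \<open>k\<close> blocks, into which \<open>graft n\<close> embeds the pairs.\<close>
  have "finite (SIGMA R:root_partitions n. T R)"
    by (rule inj_on_finite[OF inj_on_subset[OF graft(1) sub]  _ fin[of k]])
       (use \<open>{P \<in> ?L. card P = k} = _\<close> in blast)
  then have "finite (T R)" if "R \<in> root_partitions n" for R
  proof -
    have "Pair R ` T R \<subseteq> (SIGMA R:root_partitions n. T R)" using that by blast
    from finite_subset[OF this \<open>finite (Sigma _ _)\<close>] show ?thesis
      by (rule finite_imageD) (simp add: inj_on_def)
  qed
  then have "?c k = (\<Sum>R\<in>root_partitions n. card (T R))"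
    unfolding eq using finite_root_partitions by (intro card_SigmaI) blast+
  also have "\<dots> = (\<Sum>R\<in>root_partitions n. w (card (\<Union>R)) (card R))"
  proof (intro sum.cong refl)
    fix R assume "R \<in> root_partitions n"
    then have R: "\<Union>R \<subseteq> {..<n}" by (simp add: root_partitions_def)
    let ?I = "{..<n} - \<Union>R"
    have "card ?I = n - card (\<Union>R)"
      using R by (simp add: card_Diff_subset finite_subset)
    \<comment> \<open>Any numbering of the remaining letters will do, since the sum over tuples is
      invariant under reindexing.\<close>
    then obtain h where h: "bij_betw h {1..n - card (\<Union>R)} ?I"
      using finite_same_card_bij[of "{1..n - card (\<Union>R)}" ?I] by auto
    have "card (T R) = (\<Sum>\<kappa>\<in>weight_tuples (card R) ?I k. \<Prod>i\<in>?I. ?c (\<kappa> i))"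
      unfolding T_def using card_lower_partition_pos fin by (intro card_PiE_weight) auto
    also have "\<dots> = w (card (\<Union>R)) (card R)"
      unfolding w_def using h by (rule sum_weight_tuples_reindex)
    finally show "card (T R) = w (card (\<Union>R)) (card R)" .
  qed
  also have "\<dots> = (\<Sum>u=0..n. \<Sum>k'=0..u. (n choose u) * Stirling u k' * w u k')"
    by (rule sum_root_partitions)
  finally show ?thesis
    unfolding lower_dsc_count_eq_card_lower_partitions w_def weight_tuples_def .
qed

end
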